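(* Let $N$ be a right nearring with identity $1$ and let $n\ge 1$. Let $\mathfrak L(N)$ and $\mathfrak L(M_n(N))$ denote the sets of ideals of $N$ and of the matrix nearring $M_n(N)$, ordered by inclusion. Then the pairs of maps $((\ )_*,(\ )^* )$ and $((\ )^+,(\ )_* )$ are Galois connections, where $(\ )_*\colon \mathfrak L(M_n(N))\to\mathfrak L(N)$ and $(\ )^*,(\ )^+\colon \mathfrak L(N)\to\mathfrak L(M_n(N))$. That is, all three maps are monotone, and for all ideals $I$ of $N$ and $\mathcal J$ of $M_n(N)$: $\mathcal J_*\subseteq I$ if and only if $\mathcal J\subseteq I^*$; and $I^+\subseteq \mathcal J$ if and only if $I\subseteq \mathcal J_*$.
   Context: A right nearring $(N,+,\cdot)$ consists of a (not necessarily abelian) group $(N,+)$ and a semigroup $(N,\cdot)$ with $(a+b)c=ac+bc$ for all $a,b,c\in N$. An ideal of $N$ is a normal subgroup $I$ of $(N,+)$ with $IN\subseteq I$ and $n(n'+i)-nn'\in I$ for all $n,n'\in N$, $i\in I$. $N^n$ is the direct sum of $n$ copies of $(N,+)$; $\pi_j\colon N^n\to N$ is the $j$-th coordinate projection. For $a\in N$ and $1\le i,j\le n$, $f_{ij}^a\colon N^n\to N^n$ sends $(x_1,\dots,x_n)$ to the vector with $ax_j$ in position $i$ and $0$ elsewhere. $M_n(N)$ is the subnearring of $M(N^n)$ (all maps $N^n\to N^n$ under pointwise addition and composition) generated by all $f_{ij}^a$, $a\in N$, $1\le i,j\le n$. For an ideal $I$ of $N$: $I^*=\{A\in M_n(N)\mid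 A\rho\in I^n\text{ for all }\rho\in N^n\}$, and $I^+$ is the ideal of $M_n(N)$ generated by $\{f_{ij}^x\mid x\in I,\ 1\le i,j\le n\}$. For an ideal $\mathcal I$ of $M_n(N)$: $\mathcal I_*=\{x\in N\mid x\in\operatorname{im}(\pi_j A)\text{ for some }A\in\mathcal I\text{ and some }j\}$. These are ideals of $M_n(N)$, $M_n(N)$ and $N$ respectively. A pair $(f,g)$ of monotone maps $f\colon P\to Q$, $g\colon Q\to P$ between partially ordered sets is a Galois connection if $f(p)\le q\iff p\le g(q)$ for all $p\in P$, $q\in Q$. *)

theory Defs
  imports "HOL-Algebra.Ring" "HOL-Algebra.Product_Groups" "HOL-Algebra.Galois_Connection"
begin

text \<open>Nearrings are carried by the record type of HOL-Algebra rings. Addition need not be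
  commutative, and neither \<open>a \<otimes> \<zero> = \<zero>\<close> nor left distributivity is assumed. The field
  \<open>one\<close> of the record is unconstrained here; a nearring with identity satisfies in addition
  \<^term>\<open>monoid N\<close>.\<close>

locale right_nearring =
  fixes N (structure)
  assumes add_group: "group (add_monoid N)"
    and nr_m_closed: "\<lbrakk>a \<in> carrier N; b \<in> carrier N\<rbrakk> \<Longrightarrow> a \<otimes> b \<in> carrier N"
    and nr_m_assoc: "\<lbrakk>a \<in> carrier N; b \<in> carrier N; c \<in> carrier N\<rbrakk>
      \<Longrightarrow> (a \<otimes> b) \<otimes> c = a \<otimes> (b \<otimes> c)"
    and nr_r_distr: "\<lbrakk>a \<in> carrier N; b \<in> carrier N; c \<in> carrier N\<rbrakk>
      \<Longrightarrow> (a \<oplus> b) \<otimes> c = a \<otimes> c \<oplus> b \<otimes> c"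

definition nearring_ideal :: "'a set \<Rightarrow> ('a, 'm) ring_scheme \<Rightarrow> bool" where
  "nearring_ideal I N \<longleftrightarrow>
     I \<lhd> add_monoid N \<and>
     (\<forall>i\<in>I. \<forall>n\<in>carrier N. i \<otimes>\<^bsub>N\<^esub> n \<in> I) \<and>
     (\<forall>n\<in>carrier N. \<forall>n'\<in>carrier N. \<forall>i\<in>I.
        n \<otimes>\<^bsub>N\<^esub> (n' \<oplus>\<^bsub>N\<^esub> i) \<ominus>\<^bsub>N\<^esub> n \<otimes>\<^bsub>N\<^esub> n' \<in> I)"

definition genideal_nr :: "('a, 'm) ring_scheme \<Rightarrow> 'a set \<Rightarrow> 'a set" where
  "genideal_nr N X = \<Inter>{I. nearring_ideal I N \<and> X \<subseteq> I}"

definition subnearring :: "'a set \<Rightarrow> ('a, 'm) ring_scheme \<Rightarrow> bool" where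
  "subnearring S N \<longleftrightarrow>
     subgroup S (add_monoid N) \<and> (\<forall>a\<in>S. \<forall>b\<in>S. a \<otimes>\<^bsub>N\<^esub> b \<in> S)"

definition gen_subnearring :: "('a, 'm) ring_scheme \<Rightarrow> 'a set \<Rightarrow> 'a set" where
  "gen_subnearring N X = \<Inter>{S. subnearring S N \<and> X \<subseteq> S}"

text \<open>The nearring \<open>M(G)\<close> of all self-maps of a group \<open>G\<close>, which is written multiplicatively
  as in HOL-Algebra. Maps are extensional, so that equality of record elements is equality
  of maps on the carrier.\<close>

definition map_nearring :: "('a, 'm) monoid_scheme \<Rightarrow> ('a \<Rightarrow> 'a) ring" where
  "map_nearring G =
     \<lparr>carrier = carrier G \<rightarrow>\<^sub>E carrier G,
      mult = compose (carrier G),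
      one = (\<lambda>x\<in>carrier G. x),
      zero = (\<lambda>x\<in>carrier G. \<one>\<^bsub>G\<^esub>),
      add = (\<lambda>f g. \<lambda>x\<in>carrier G. f x \<otimes>\<^bsub>G\<^esub> g x)\<rparr>"

text \<open>\<open>N\<^sup>n\<close>: vectors are extensional functions on \<open>{1..n}\<close>, so the coordinate projection
  \<open>\<pi>\<^sub>j\<close> is application to \<open>j\<close>.\<close>

definition vec_group :: "('a, 'm) ring_scheme \<Rightarrow> nat \<Rightarrow> (nat \<Rightarrow> 'a) monoid" where
  "vec_group N n = product_group {1..n} (\<lambda>_. add_monoid N)"

definition elem_mat ::
  "('a, 'm) ring_scheme \<Rightarrow> nat \<Rightarrow> nat \<Rightarrow> nat \<Rightarrow> 'a \<Rightarrow> (nat \<Rightarrow> 'a) \<Rightarrow> (nat \<Rightarrow> 'a)" where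
  "elem_mat N n i j a =
     (\<lambda>x\<in>carrier (vec_group N n). \<lambda>k\<in>{1..n}. if k = i then a \<otimes>\<^bsub>N\<^esub> x j else \<zero>\<^bsub>N\<^esub>)"

definition matrix_nearring ::
  "('a, 'm) ring_scheme \<Rightarrow> nat \<Rightarrow> ((nat \<Rightarrow> 'a) \<Rightarrow> (nat \<Rightarrow> 'a)) ring" where
  "matrix_nearring N n =
     (map_nearring (vec_group N n))
       \<lparr>carrier := gen_subnearring (map_nearring (vec_group N n))
          {elem_mat N n i j a | i j a. i \<in> {1..n} \<and> j \<in> {1..n} \<and> a \<in> carrier N}\<rparr>"

text \<open>\<open>I\<^sup>*\<close>, \<open>I\<^sup>+\<close> and \<open>J\<^sub>*\<close>, in this order.\<close>

definition upper_star ::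
  "('a, 'm) ring_scheme \<Rightarrow> nat \<Rightarrow> 'a set \<Rightarrow> ((nat \<Rightarrow> 'a) \<Rightarrow> (nat \<Rightarrow> 'a)) set" where
  "upper_star N n I =
     {A \<in> carrier (matrix_nearring N n).
        \<forall>\<rho>\<in>carrier (vec_group N n). A \<rho> \<in> {1..n} \<rightarrow>\<^sub>E I}"

definition upper_plus ::
  "('a, 'm) ring_scheme \<Rightarrow> nat \<Rightarrow> 'a set \<Rightarrow> ((nat \<Rightarrow> 'a) \<Rightarrow> (nat \<Rightarrow> 'a)) set" where
  "upper_plus N n I =
     genideal_nr (matrix_nearring N n)
       {elem_mat N n i j x | i j x. i \<in> {1..n} \<and> j \<in> {1..n} \<and> x \<in> I}"

definition lower_star ::
  "('a, 'm) ring_scheme \<Rightarrow> nat \<Rightarrow> ((nat \<Rightarrow> 'a) \<Rightarrow> (nat \<Rightarrow> 'a)) set \<Rightarrow> 'a set" where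
  "lower_star N n J =
     {x \<in> carrier N. \<exists>A\<in>J. \<exists>j\<in>{1..n}. x \<in> (\<lambda>\<rho>. A \<rho> j) ` carrier (vec_group N n)}"

definition ideal_order :: "('a, 'm) ring_scheme \<Rightarrow> 'a set gorder" where
  "ideal_order N = \<lparr>carrier = {I. nearring_ideal I N}, eq = (=), le = (\<subseteq>)\<rparr>"

end

theory Submission
  imports Defs
begin

text \<open>Every \<open>A \<in> M\<^sub>n(N)\<close> preserves, coordinatewise, each subgroup of \<open>N \<times> N\<close> that is invariant
  under simultaneous left multiplication, because the generators do. For the congruence modulo an
  ideal \<open>I\<close> this makes \<open>I\<^sup>*\<close> an ideal. For the graph of right multiplication by \<open>y\<close> it gives
  \<open>A (\<rho> y) = (A \<rho>) y\<close>, so that an entry \<open>x = (A \<rho>)\<^sub>j\<close> with \<open>A \<in> J\<close> can be isolated: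
  \<open>f\<^sub>1\<^sub>1\<^sup>x = f\<^sub>1\<^sub>j\<^sup>1 A (\<Sum>\<^sub>k f\<^sub>k\<^sub>1\<^bsup>\<rho> k\<^esup>) \<in> J\<close>. Hence \<open>J\<^sub>*\<close> is the preimage of \<open>J\<close> under the homomorphism
  \<open>a \<mapsto> f\<^sub>1\<^sub>1\<^sup>a\<close>, and all \<open>f\<^sub>i\<^sub>j\<^sup>x\<close> with \<open>x \<in> J\<^sub>*\<close> lie in \<open>J\<close>. Both adjunctions follow.\<close>

subsection \<open>Nearrings and their ideals\<close>

sublocale right_nearring \<subseteq> add: group "add_monoid N"
  rewrites "carrier (add_monoid N) = carrier N"
    and "mult (add_monoid N) = add N"
    and "one (add_monoid N) = zero N"
    and "m_inv (add_monoid N) = a_inv N"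
  by (rule add_group) (auto simp: a_inv_def)

lemma (in right_nearring) zero_mult:
  assumes "a \<in> carrier N"
  shows "\<zero> \<otimes> a = \<zero>"
proof -
  have "\<zero> \<otimes> a \<oplus> \<zero> \<otimes> a = \<zero> \<otimes> a"
    using nr_r_distr[of \<zero> \<zero> a] assms by simp
  then show ?thesis
    using assms nr_m_closed by simp
qed

lemma (in right_nearring) minus_mult:
  assumes "a \<in> carrier N" "b \<in> carrier N"
  shows "(\<ominus> a) \<otimes> b = \<ominus> (a \<otimes> b)"
proof -
  have "(\<ominus> a) \<otimes> b \<oplus> a \<otimes> b = \<zero>"
    using nr_r_distr[of "\<ominus> a" a b] assms by (simp add: zero_mult)
  then show ?thesis
    using assms nr_m_closed add.inv_equality by simp
qed

lemma (in right_nearring) subnearring_imp_nearring: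
  assumes "subnearring S N"
  shows "right_nearring (N\<lparr>carrier := S\<rparr>)"
proof -
  have S: "subgroup S (add_monoid N)" and mult: "\<And>a b. a \<in> S \<Longrightarrow> b \<in> S \<Longrightarrow> a \<otimes> b \<in> S"
    using assms by (auto simp: subnearring_def)
  have sub: "S \<subseteq> carrier N"
    using subgroup.subset[OF S] by simp
  show ?thesis
  proof (rule right_nearring.intro)
    show "group (add_monoid (N\<lparr>carrier := S\<rparr>))"
      using group.subgroup_imp_group[OF add_group S] by simp
  qed (use sub in \<open>auto simp: mult intro: nr_m_assoc nr_r_distr\<close>)
qed

lemma (in right_nearring) subnearring_gen:
  assumes "X \<subseteq> carrier N"
  shows "subnearring (gen_subnearring N X) N"
proof -
  \<comment> \<open>The family to be intersected must be nonempty; \<open>carrier N\<close> is a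
    member of it.\<close>
  have "subnearring (carrier N) N"
    using group.subgroup_self[OF add_group] by (simp add: subnearring_def nr_m_closed)
  then have "subgroup (\<Inter>{S. subnearring S N \<and> X \<subseteq> S}) (add_monoid N)"
    using assms by (intro group.subgroups_Inter[OF add_group]) (auto simp: subnearring_def)
  then show ?thesis
    by (auto simp: gen_subnearring_def subnearring_def)
qed

lemma gen_subnearring_least:
  assumes "subnearring S N" "X \<subseteq> S"
  shows "gen_subnearring N X \<subseteq> S"
  using assms by (auto simp: gen_subnearring_def)

lemma gen_subnearring_superset: "X \<subseteq> gen_subnearring N X"
  by (auto simp: gen_subnearring_def)

text \<open>Normality becomes closure under conjugation, so each clause is a closure condition on
  elements. Such conditions can be intersected, pulled back and checked entrywise.\<close>

lemma (in right_nearring) nearring_ideal_iff: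
  "nearring_ideal I N \<longleftrightarrow>
     subgroup I (add_monoid N) \<and>
     (\<forall>n\<in>carrier N. \<forall>i\<in>I. n \<oplus> i \<oplus> \<ominus> n \<in> I) \<and>
     (\<forall>i\<in>I. \<forall>n\<in>carrier N. i \<otimes> n \<in> I) \<and>
     (\<forall>n\<in>carrier N. \<forall>n'\<in>carrier N. \<forall>i\<in>I. n \<otimes> (n' \<oplus> i) \<ominus> n \<otimes> n' \<in> I)"
  unfolding nearring_ideal_def by (auto simp: group.normal_inv_iff[OF add_group] a_inv_def)

lemma (in right_nearring) nearring_ideal_genideal:
  assumes "X \<subseteq> carrier N"
  shows "nearring_ideal (genideal_nr N X) N"
proof -
  have "nearring_ideal (carrier N) N"
    using group.subgroup_self[OF add_group]
    by (simp add: nearring_ideal_iff nr_m_closed a_minus_def)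
  then have "subgroup (\<Inter>{I. nearring_ideal I N \<and> X \<subseteq> I}) (add_monoid N)"
    using assms by (intro group.subgroups_Inter[OF add_group]) (auto simp: nearring_ideal_iff)
  then show ?thesis
    unfolding genideal_nr_def by (subst nearring_ideal_iff) (simp add: nearring_ideal_iff)
qed

text \<open>The universal property of the generated ideal. It reduces
  \<open>I^+ \<subseteq> J\<close> to a statement about elementary matrices.\<close>

lemma genideal_nr_least:
  assumes "nearring_ideal J N"
  shows "genideal_nr N X \<subseteq> J \<longleftrightarrow> X \<subseteq> J"
  using assms by (auto simp: genideal_nr_def)

text \<open>Since \<open>h\<close> respects sums, negatives and products, each ideal condition for
  the preimage is the image condition for \<open>J\<close>. Intended for
  \<open>h = elem_mat N n 1 1\<close>.\<close>

lemma nearring_ideal_vimage: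
  assumes N: "right_nearring N" and M: "right_nearring M"
    and closed: "\<And>a. a \<in> carrier N \<Longrightarrow> h a \<in> carrier M"
    and add: "\<And>a b. a \<in> carrier N \<Longrightarrow> b \<in> carrier N \<Longrightarrow> h (a \<oplus>\<^bsub>N\<^esub> b) = h a \<oplus>\<^bsub>M\<^esub> h b"
    and mult: "\<And>a b. a \<in> carrier N \<Longrightarrow> b \<in> carrier N \<Longrightarrow> h (a \<otimes>\<^bsub>N\<^esub> b) = h a \<otimes>\<^bsub>M\<^esub> h b"
    and J: "nearring_ideal J M"
  shows "nearring_ideal {a \<in> carrier N. h a \<in> J} N"
proof -
  interpret N: right_nearring N by (rule N)
  interpret M: right_nearring M by (rule M)
  interpret h: group_hom "add_monoid N" "add_monoid M" h
    using closed add N.add_group M.add_group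
    by (auto simp: group_hom_def group_hom_axioms_def hom_def)
  have zero: "h \<zero>\<^bsub>N\<^esub> = \<zero>\<^bsub>M\<^esub>"
    using h.hom_one by simp
  have inv: "h (\<ominus>\<^bsub>N\<^esub> a) = \<ominus>\<^bsub>M\<^esub> h a" if "a \<in> carrier N" for a
    using h.hom_inv[of a] that by (simp add: a_inv_def)
  have J': "subgroup J (add_monoid M)"
    using J by (simp add: M.nearring_ideal_iff)
  have "subgroup {a \<in> carrier N. h a \<in> J} (add_monoid N)"
  proof (rule N.add.subgroupI)
    have "\<zero>\<^bsub>N\<^esub> \<in> {a \<in> carrier N. h a \<in> J}"
      using subgroup.one_closed[OF J'] by (simp add: zero)
    then show "{a \<in> carrier N. h a \<in> J} \<noteq> {}" by blast
  qed (use subgroup.m_closed[OF J'] subgroup.m_inv_closed[OF J'] in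
      \<open>auto simp: add inv simp flip: a_inv_def\<close>)
  then show ?thesis
    using J unfolding N.nearring_ideal_iff M.nearring_ideal_iff
    by (simp add: add mult inv closed N.nr_m_closed a_minus_def)
qed

subsection \<open>Maps and matrices\<close>

text \<open>Additively, \<open>M(G)\<close> is the power of \<open>G\<close> indexed by the carrier
  of \<open>G\<close>, so its group laws and inverses are those of a product group.\<close>

lemma add_monoid_map_nearring:
  "add_monoid (map_nearring G) = product_group (carrier G) (\<lambda>_. G)"
  by (simp add: map_nearring_def product_group_def)

lemma map_nearring_simps:
  "carrier (map_nearring G) = carrier G \<rightarrow>\<^sub>E carrier G"
  "mult (map_nearring G) = compose (carrier G)"
  "zero (map_nearring G) = (\<lambda>x\<in>carrier G. \<one>\<^bsub>G\<^esub>)"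
  "add (map_nearring G) = (\<lambda>f g. \<lambda>x\<in>carrier G. f x \<otimes>\<^bsub>G\<^esub> g x)"
  by (simp_all add: map_nearring_def)

text \<open>Right distributivity holds because sums are pointwise: precomposing with a map only
  changes the point of evaluation.\<close>

lemma (in group) right_nearring_map_nearring: "right_nearring (map_nearring G)"
proof (rule right_nearring.intro)
  show "group (add_monoid (map_nearring G))"
    unfolding add_monoid_map_nearring by (rule product_group) (rule is_group)
qed (auto simp: map_nearring_simps compose_def PiE_iff Pi_iff fun_eq_iff restrict_def extensional_def)

lemma (in group) map_nearring_a_inv:
  assumes "f \<in> carrier (map_nearring G)"
  shows "\<ominus>\<^bsub>map_nearring G\<^esub> f = (\<lambda>x\<in>carrier G. inv f x)"
  using assms unfolding a_inv_def add_monoid_map_nearring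
  by (subst inv_product_group) (auto simp: map_nearring_simps)

text \<open>Closure under pointwise sums and negatives is inherited from the subgroup
  \<open>R\<close>, and composites preserve what both factors preserve. Preservation of
  \<open>R\<close> on a generated subnearring can therefore be tested on generators.\<close>

lemma (in group) subnearring_relation_preserving:
  assumes "subgroup R (G \<times>\<times> G)"
  shows "subnearring {f \<in> carrier (map_nearring G). \<forall>x y. (x, y) \<in> R \<longrightarrow> (f x, f y) \<in> R}
    (map_nearring G)"
    (is "subnearring ?S ?M")
proof -
  interpret M: right_nearring ?M by (rule right_nearring_map_nearring)
  have R: "R \<subseteq> carrier G \<times> carrier G"
    using subgroup.subset[OF assms] by simp
  have R1: "(\<one>, \<one>) \<in> R"
    using subgroup.one_closed[OF assms] by simp
  have Rm: "(x \<otimes> x', y \<otimes> y') \<in> R" if "(x, y) \<in> R" "(x', y') \<in> R" for x y x' y'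
    using subgroup.m_closed[OF assms that] by simp
  have Ri: "(inv x, inv y) \<in> R" if "(x, y) \<in> R" for x y
    using subgroup.m_inv_closed[OF assms that] that R by (auto simp: inv_DirProd[OF is_group is_group])
  have "subgroup ?S (add_monoid ?M)"
  proof (rule M.add.subgroupI)
    have "\<zero>\<^bsub>?M\<^esub> \<in> ?S"
      using R R1 M.add.one_closed by (auto simp: map_nearring_simps)
    then show "?S \<noteq> {}" by blast
    show "\<ominus>\<^bsub>?M\<^esub> f \<in> ?S" if "f \<in> ?S" for f
      using that R M.add.inv_closed[of f] Ri
      by (auto simp: map_nearring_a_inv)
    show "f \<oplus>\<^bsub>?M\<^esub> g \<in> ?S" if "f \<in> ?S" "g \<in> ?S" for f g
      using that R M.add.m_closed[of f g] Rm by (auto simp: map_nearring_simps)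
  qed auto
  moreover have "f \<otimes>\<^bsub>?M\<^esub> g \<in> ?S" if "f \<in> ?S" "g \<in> ?S" for f g
    using that R M.nr_m_closed[of f g] by (auto simp: map_nearring_simps compose_def)
  ultimately show ?thesis
    by (simp add: subnearring_def)
qed

section \<open>Coordinatewise computation in \<open>N^n\<close> and in the matrix nearring\<close>

lemma carrier_vec_group: "carrier (vec_group N n) = {1..n} \<rightarrow>\<^sub>E carrier N"
  by (simp add: vec_group_def)

lemma mult_vec_group: "mult (vec_group N n) = (\<lambda>x y. \<lambda>k\<in>{1..n}. x k \<oplus>\<^bsub>N\<^esub> y k)"
  by (simp add: vec_group_def)

lemma one_vec_group: "one (vec_group N n) = (\<lambda>k\<in>{1..n}. \<zero>\<^bsub>N\<^esub>)"
  by (simp add: vec_group_def)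

context right_nearring
begin

lemma group_vec_group: "group (vec_group N n)"
  by (simp add: vec_group_def add_group)

lemma inv_vec_group:
  "x \<in> carrier (vec_group N n) \<Longrightarrow> inv\<^bsub>vec_group N n\<^esub> x = (\<lambda>k\<in>{1..n}. \<ominus> x k)"
  unfolding vec_group_def by (subst inv_product_group) (auto simp: add_group a_inv_def)

lemma elem_mat_map:
  assumes "j \<in> {1..n}" "a \<in> carrier N"
  shows "elem_mat N n i j a \<in> carrier (map_nearring (vec_group N n))"
  using assms by (auto simp: elem_mat_def map_nearring_simps carrier_vec_group nr_m_closed PiE_iff)

lemma elem_mat_apply:
  assumes "x \<in> carrier (vec_group N n)" "k \<in> {1..n}"
  shows "elem_mat N n i j a x k = (if k = i then a \<otimes> x j else \<zero>)"
  using assms by (simp add: elem_mat_def)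

lemma subnearring_matrix:
  "subnearring (carrier (matrix_nearring N n)) (map_nearring (vec_group N n))"
proof -
  interpret M: right_nearring "map_nearring (vec_group N n)"
    by (rule group.right_nearring_map_nearring[OF group_vec_group])
  show ?thesis
    by (auto simp: matrix_nearring_def elem_mat_map intro!: M.subnearring_gen)
qed

lemma right_nearring_matrix: "right_nearring (matrix_nearring N n)"
proof -
  interpret M: right_nearring "map_nearring (vec_group N n)"
    by (rule group.right_nearring_map_nearring[OF group_vec_group])
  show ?thesis
    using M.subnearring_imp_nearring[OF subnearring_matrix]
    by (simp add: matrix_nearring_def)
qed

lemma elem_mat_closed:
  assumes "i \<in> {1..n}" "j \<in> {1..n}" "a \<in> carrier N"
  shows "elem_mat N n i j a \<in> carrier (matrix_nearring N n)"
  using assms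
  by (auto simp: matrix_nearring_def intro!: subsetD[OF gen_subnearring_superset])

lemma matrix_in_map:
  "A \<in> carrier (matrix_nearring N n) \<Longrightarrow> A \<in> carrier (vec_group N n) \<rightarrow>\<^sub>E carrier (vec_group N n)"
  using subnearring_matrix[of n] subgroup.subset
  by (fastforce simp: subnearring_def map_nearring_simps)

lemma matrix_apply_closed:
  "\<lbrakk>A \<in> carrier (matrix_nearring N n); x \<in> carrier (vec_group N n)\<rbrakk>
    \<Longrightarrow> A x \<in> carrier (vec_group N n)"
  using matrix_in_map by blast

text \<open>Extensionality is applied twice: matrices are extensional on \<open>N^n\<close>, and
  their values are extensional on \<open>{1..n}\<close>.\<close>

lemma matrix_eqI:
  assumes "A \<in> carrier (matrix_nearring N n)" "B \<in> carrier (matrix_nearring N n)"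
    and "\<And>x k. x \<in> carrier (vec_group N n) \<Longrightarrow> k \<in> {1..n} \<Longrightarrow> A x k = B x k"
  shows "A = B"
proof (rule PiE_ext[OF matrix_in_map matrix_in_map])
  fix x assume x: "x \<in> carrier (vec_group N n)"
  show "A x = B x"
    using matrix_apply_closed[OF assms(1) x] matrix_apply_closed[OF assms(2) x] assms(3)[OF x]
    unfolding carrier_vec_group by (rule PiE_ext)
qed (use assms in auto)

lemma matrix_add_apply:
  assumes "x \<in> carrier (vec_group N n)" "k \<in> {1..n}"
  shows "(A \<oplus>\<^bsub>matrix_nearring N n\<^esub> B) x k = A x k \<oplus> B x k"
  using assms by (simp add: matrix_nearring_def map_nearring_simps mult_vec_group)

lemma matrix_zero_apply:
  assumes "x \<in> carrier (vec_group N n)" "k \<in> {1..n}"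
  shows "\<zero>\<^bsub>matrix_nearring N n\<^esub> x k = \<zero>"
  using assms by (simp add: matrix_nearring_def map_nearring_simps one_vec_group)

lemma matrix_mult_apply:
  assumes "x \<in> carrier (vec_group N n)"
  shows "(A \<otimes>\<^bsub>matrix_nearring N n\<^esub> B) x = A (B x)"
  using assms by (simp add: matrix_nearring_def map_nearring_simps compose_def)

lemma matrix_inv_apply:
  assumes "A \<in> carrier (matrix_nearring N n)" "x \<in> carrier (vec_group N n)" "k \<in> {1..n}"
  shows "(\<ominus>\<^bsub>matrix_nearring N n\<^esub> A) x k = \<ominus> A x k"
proof -
  interpret M: right_nearring "matrix_nearring N n" by (rule right_nearring_matrix)
  \<comment> \<open>Negation refers to the smaller carrier of the matrix nearring, so its entries
    are identified by uniqueness of inverses in \<open>N\<close> instead of by unfolding.\<close>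
  have "(\<ominus>\<^bsub>matrix_nearring N n\<^esub> A) x k \<oplus> A x k = \<zero>"
    using matrix_add_apply[OF assms(2,3), of "\<ominus>\<^bsub>matrix_nearring N n\<^esub> A" A]
    unfolding M.add.l_inv[OF assms(1)] matrix_zero_apply[OF assms(2,3)] by (rule sym)
  moreover have "A x k \<in> carrier N" "(\<ominus>\<^bsub>matrix_nearring N n\<^esub> A) x k \<in> carrier N"
    using assms matrix_apply_closed[OF M.add.inv_closed[OF assms(1)] assms(2)]
      matrix_apply_closed[OF assms(1,2)]
    by (auto simp: carrier_vec_group)
  ultimately show ?thesis
    by (rule add.inv_equality[symmetric])
qed

text \<open>Lifted coordinatewise, \<open>R\<close> becomes a subgroup \<open>Q\<close> of
  \<open>N^n \<times> N^n\<close>. The maps preserving \<open>Q\<close> form a subnearring that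
  contains the generators, hence every matrix.\<close>

lemma matrix_preserves_relation:
  assumes R: "subgroup R (add_monoid N \<times>\<times> add_monoid N)"
    and left: "\<And>a x y. a \<in> carrier N \<Longrightarrow> (x, y) \<in> R \<Longrightarrow> (a \<otimes> x, a \<otimes> y) \<in> R"
    and A: "A \<in> carrier (matrix_nearring N n)"
    and u: "u \<in> carrier (vec_group N n)" and v: "v \<in> carrier (vec_group N n)"
    and uv: "\<And>k. k \<in> {1..n} \<Longrightarrow> (u k, v k) \<in> R"
    and k: "k \<in> {1..n}"
  shows "(A u k, A v k) \<in> R"
proof -
  let ?V = "vec_group N n"
  interpret V: group ?V by (rule group_vec_group)
  define Q where "Q = {(u, v). u \<in> carrier ?V \<and> v \<in> carrier ?V \<and> (\<forall>k\<in>{1..n}. (u k, v k) \<in> R)}"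
  have R1: "(\<zero>, \<zero>) \<in> R"
    using subgroup.one_closed[OF R] by simp
  have Rm: "(x \<oplus> x', y \<oplus> y') \<in> R" if "(x, y) \<in> R" "(x', y') \<in> R" for x y x' y'
    using subgroup.m_closed[OF R that] by simp
  have Ri: "(\<ominus> x, \<ominus> y) \<in> R" if "(x, y) \<in> R" for x y
    using subgroup.m_inv_closed[OF R that] that subgroup.subset[OF R]
    by (auto simp: inv_DirProd[OF add_group add_group] a_inv_def)
  have "subgroup Q (?V \<times>\<times> ?V)"
  proof (rule group.subgroupI[OF DirProd_group[OF V.is_group V.is_group]])
    have "(\<one>\<^bsub>?V\<^esub>, \<one>\<^bsub>?V\<^esub>) \<in> Q"
      using V.one_closed R1 unfolding Q_def by (auto simp: one_vec_group)
    then show "Q \<noteq> {}" by blast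
    show "inv\<^bsub>?V \<times>\<times> ?V\<^esub> p \<in> Q" if "p \<in> Q" for p
    proof -
      obtain x y where p: "p = (x, y)" "x \<in> carrier ?V" "y \<in> carrier ?V"
        "\<forall>k\<in>{1..n}. (x k, y k) \<in> R"
        using \<open>p \<in> Q\<close> by (auto simp: Q_def)
      then show ?thesis
        using V.inv_closed[OF p(2)] V.inv_closed[OF p(3)] Ri
        by (auto simp: Q_def inv_DirProd[OF V.is_group V.is_group] inv_vec_group)
    qed
    show "p \<otimes>\<^bsub>?V \<times>\<times> ?V\<^esub> q \<in> Q" if "p \<in> Q" "q \<in> Q" for p q
    proof -
      obtain x y x' y' where p: "p = (x, y)" "x \<in> carrier ?V" "y \<in> carrier ?V"
        "\<forall>k\<in>{1..n}. (x k, y k) \<in> R" "q = (x', y')" "x' \<in> carrier ?V" "y' \<in> carrier ?V"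
        "\<forall>k\<in>{1..n}. (x' k, y' k) \<in> R"
        using \<open>p \<in> Q\<close> \<open>q \<in> Q\<close> by (auto simp: Q_def)
      then show ?thesis
        using V.m_closed[OF p(2) p(6)] V.m_closed[OF p(3) p(7)] Rm
        by (auto simp: Q_def mult_vec_group)
    qed
  qed (auto simp: Q_def)
  note sub = V.subnearring_relation_preserving[OF this]
  \<comment> \<open>Row \<open>i\<close> yields the pair
    \<open>(a \<otimes> x j, a \<otimes> y j)\<close>, covered by left invariance; every other row
    yields \<open>(\<zero>, \<zero>)\<close>.\<close>
  have gen: "(elem_mat N n i j a x, elem_mat N n i j a y) \<in> Q"
    if "i \<in> {1..n}" "j \<in> {1..n}" "a \<in> carrier N" "(x, y) \<in> Q" for i j a x y
    using that matrix_apply_closed[OF elem_mat_closed[OF that(1-3)]] left R1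
    by (auto simp: Q_def elem_mat_apply)
  have "carrier (matrix_nearring N n) \<subseteq>
      {f \<in> carrier (map_nearring ?V). \<forall>x y. (x, y) \<in> Q \<longrightarrow> (f x, f y) \<in> Q}"
    unfolding matrix_nearring_def partial_object.simps
    by (simp, rule gen_subnearring_least[OF sub]) (use gen in \<open>auto simp: elem_mat_map\<close>)
  moreover have "(u, v) \<in> Q"
    using u v uv by (simp add: Q_def)
  ultimately have "(A u, A v) \<in> Q"
    using A by blast
  then show ?thesis
    using k by (simp add: Q_def)
qed

text \<open>The graph of right multiplication by \<open>y\<close> is a subgroup of
  \<open>N \<times> N\<close> by right distributivity, and left invariant by associativity.\<close>

lemma matrix_right_mult:
  assumes A: "A \<in> carrier (matrix_nearring N n)" and x: "x \<in> carrier (vec_group N n)"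
    and y: "y \<in> carrier N" and k: "k \<in> {1..n}"
  shows "A (\<lambda>k\<in>{1..n}. x k \<otimes> y) k = A x k \<otimes> y"
proof -
  let ?R = "{(a, b). a \<in> carrier N \<and> b = a \<otimes> y}"
  have "subgroup ?R (add_monoid N \<times>\<times> add_monoid N)"
  proof (rule group.subgroupI[OF DirProd_group[OF add_group add_group]])
    have "(\<zero>, \<zero>) \<in> ?R"
      using y by (simp add: zero_mult)
    then show "?R \<noteq> {}" by blast
  qed (use y in \<open>auto simp: nr_m_closed nr_r_distr minus_mult inv_DirProd[OF add_group add_group]
      simp flip: a_inv_def\<close>)
  then have "(A x k, A (\<lambda>k\<in>{1..n}. x k \<otimes> y) k) \<in> ?R"
    by (rule matrix_preserves_relation[OF _ _ A x])
      (use x y k in \<open>auto simp: nr_m_closed nr_m_assoc carrier_vec_group PiE_iff\<close>)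
  then show ?thesis by simp
qed

text \<open>Congruence modulo \<open>I\<close> is a subgroup of \<open>N \<times> N\<close> because
  \<open>I\<close> is normal, and left invariant by the ideal axiom on differences.\<close>

lemma matrix_cong_ideal:
  assumes I: "nearring_ideal I N" and A: "A \<in> carrier (matrix_nearring N n)"
    and u: "u \<in> carrier (vec_group N n)" and v: "v \<in> carrier (vec_group N n)"
    and uv: "\<And>k. k \<in> {1..n} \<Longrightarrow> u k \<ominus> v k \<in> I" and k: "k \<in> {1..n}"
  shows "A u k \<ominus> A v k \<in> I"
proof -
  interpret I: normal I "add_monoid N"
    using I by (simp add: nearring_ideal_def)
  \<comment> \<open>Written as equality of right cosets, congruence passes to sums and inverses by
    the calculus of cosets of a normal subgroup.\<close>
  have coset: "I #>\<^bsub>add_monoid N\<^esub> x = I #>\<^bsub>add_monoid N\<^esub> y \<longleftrightarrow> x \<ominus> y \<in> I"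
    if "x \<in> carrier N" "y \<in> carrier N" for x y
    using that I.rcos_module[OF add_group, of y x] add.rcos_self[of x]
      add.repr_independence[of x I y] I.subgroup_axioms
    by (auto simp: a_minus_def a_inv_def)
  let ?R = "{(a, b). a \<in> carrier N \<and> b \<in> carrier N \<and> I #>\<^bsub>add_monoid N\<^esub> a = I #>\<^bsub>add_monoid N\<^esub> b}"
  have R: "subgroup ?R (add_monoid N \<times>\<times> add_monoid N)"
  proof (rule group.subgroupI[OF DirProd_group[OF add_group add_group]])
    have "(\<zero>, \<zero>) \<in> ?R" by simp
    then show "?R \<noteq> {}" by blast
  next
    fix p assume "p \<in> ?R"
    then obtain a b where p: "p = (a, b)" "a \<in> carrier N" "b \<in> carrier N"
      "I #>\<^bsub>add_monoid N\<^esub> a = I #>\<^bsub>add_monoid N\<^esub> b"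
      by auto
    then show "inv\<^bsub>add_monoid N \<times>\<times> add_monoid N\<^esub> p \<in> ?R"
      using I.rcos_inv[of a] I.rcos_inv[of b]
      by (auto simp: inv_DirProd[OF add_group add_group] simp flip: a_inv_def)
  next
    fix p q assume "p \<in> ?R" "q \<in> ?R"
    then obtain a b a' b' where p: "p = (a, b)" "a \<in> carrier N" "b \<in> carrier N"
      "I #>\<^bsub>add_monoid N\<^esub> a = I #>\<^bsub>add_monoid N\<^esub> b" "q = (a', b')" "a' \<in> carrier N" "b' \<in> carrier N"
      "I #>\<^bsub>add_monoid N\<^esub> a' = I #>\<^bsub>add_monoid N\<^esub> b'"
      by auto
    then show "p \<otimes>\<^bsub>add_monoid N \<times>\<times> add_monoid N\<^esub> q \<in> ?R"
      using I.rcos_sum[of a a'] I.rcos_sum[of b b'] by auto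
  qed auto
  have left: "(a \<otimes> x, a \<otimes> y) \<in> ?R" if "a \<in> carrier N" "(x, y) \<in> ?R" for a x y
  proof -
    have x: "x \<in> carrier N" "y \<in> carrier N" "x \<in> I #>\<^bsub>add_monoid N\<^esub> y"
      using that add.rcos_self[of x] I.subgroup_axioms by auto
    \<comment> \<open>Exchanging right for left cosets puts \<open>x\<close> in the form
      \<open>y \<oplus> i\<close>, to which the ideal axiom on differences applies.\<close>
    then have "x \<in> y <#\<^bsub>add_monoid N\<^esub> I"
      using I.coset_eq by simp
    then obtain i where i: "i \<in> I" "x = y \<oplus> i"
      by (auto simp: l_coset_def)
    have "a \<otimes> x \<ominus> a \<otimes> y \<in> I"
      using I i that(1) x by (simp add: nearring_ideal_iff)
    then show ?thesis
      using that(1) x nr_m_closed coset by simp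
  qed
  have "(A u k, A v k) \<in> ?R"
    by (rule matrix_preserves_relation[OF R left A u v])
      (use u v uv k in \<open>simp_all add: coset PiE_iff carrier_vec_group\<close>)
  then show ?thesis
    using coset by auto
qed

end

subsection \<open>The three maps between ideals\<close>

context right_nearring
begin

text \<open>The ideal conditions are checked entry by entry. The one on differences is not an
  entrywise identity, since \<open>B\<close> mixes coordinates; it rests on
  \<open>matrix_cong_ideal\<close>.\<close>

lemma nearring_ideal_upper_star:
  assumes I: "nearring_ideal I N"
  shows "nearring_ideal (upper_star N n I) (matrix_nearring N n)"
proof -
  let ?M = "matrix_nearring N n"
  interpret M: right_nearring ?M by (rule right_nearring_matrix)
  have I': "subgroup I (add_monoid N)"
    using I by (simp add: nearring_ideal_iff)
  have I0: "\<zero> \<in> I"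
    using subgroup.one_closed[OF I'] by simp
  \<comment> \<open>The values of a matrix are already extensional vectors, so only their entries
    have to be tested.\<close>
  have star: "A \<in> upper_star N n I \<longleftrightarrow>
      A \<in> carrier ?M \<and> (\<forall>x\<in>carrier (vec_group N n). \<forall>k\<in>{1..n}. A x k \<in> I)" for A
    using matrix_apply_closed[of A n] by (auto simp: upper_star_def carrier_vec_group PiE_iff)
  have entry: "A x k \<in> carrier N"
    if "A \<in> carrier ?M" "x \<in> carrier (vec_group N n)" "k \<in> {1..n}" for A x k
    using matrix_apply_closed[OF that(1,2)] that(3) by (auto simp: carrier_vec_group)
  have "subgroup (upper_star N n I) (add_monoid ?M)"
  proof (rule M.add.subgroupI)
    have "\<zero>\<^bsub>?M\<^esub> \<in> upper_star N n I"
      by (simp add: star matrix_zero_apply I0)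
    then show "upper_star N n I \<noteq> {}" by blast
  qed (use subgroup.m_closed[OF I'] subgroup.m_inv_closed[OF I'] in
      \<open>auto simp: star matrix_add_apply matrix_inv_apply simp flip: a_inv_def\<close>)
  moreover have "B \<oplus>\<^bsub>?M\<^esub> A \<oplus>\<^bsub>?M\<^esub> \<ominus>\<^bsub>?M\<^esub> B \<in> upper_star N n I"
    if "B \<in> carrier ?M" "A \<in> upper_star N n I" for A B
    using that I by (auto simp: star matrix_add_apply matrix_inv_apply entry nearring_ideal_iff)
  moreover have "A \<otimes>\<^bsub>?M\<^esub> B \<in> upper_star N n I"
    if "B \<in> carrier ?M" "A \<in> upper_star N n I" for A B
    using that by (auto simp: star M.nr_m_closed matrix_mult_apply matrix_apply_closed)
  moreover have "B \<otimes>\<^bsub>?M\<^esub> (C \<oplus>\<^bsub>?M\<^esub> A) \<ominus>\<^bsub>?M\<^esub> B \<otimes>\<^bsub>?M\<^esub> C \<in> upper_star N n I"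
    if "B \<in> carrier ?M" "C \<in> carrier ?M" "A \<in> upper_star N n I" for A B C
  proof -
    have A: "A \<in> carrier ?M"
      using that star by blast
    have "B ((C \<oplus>\<^bsub>?M\<^esub> A) x) k \<ominus> B (C x) k \<in> I"
      if x: "x \<in> carrier (vec_group N n)" and k: "k \<in> {1..n}" for x k
    proof (rule matrix_cong_ideal[OF I \<open>B \<in> carrier ?M\<close> _ _ _ k])
      \<comment> \<open>The difference is the conjugate of \<open>A x k\<close> by
        \<open>C x k\<close>.\<close>
      show "(C \<oplus>\<^bsub>?M\<^esub> A) x k \<ominus> C x k \<in> I" if "k \<in> {1..n}" for k
        using x that A \<open>C \<in> carrier ?M\<close> \<open>A \<in> upper_star N n I\<close> I
        by (auto simp: star matrix_add_apply entry nearring_ideal_iff a_minus_def)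
    qed (use x A \<open>C \<in> carrier ?M\<close> in \<open>simp_all add: matrix_apply_closed\<close>)
    then show ?thesis
      using that A
      by (auto simp: star a_minus_def M.nr_m_closed matrix_add_apply matrix_inv_apply
          matrix_mult_apply)
  qed
  ultimately show ?thesis
    unfolding M.nearring_ideal_iff by blast
qed

text \<open>Both inclusions say that every entry of every vector \<open>A \<rho>\<close> with
  \<open>A \<in> J\<close> lies in \<open>I\<close>.\<close>

lemma lower_star_subset_iff:
  assumes "J \<subseteq> carrier (matrix_nearring N n)"
  shows "lower_star N n J \<subseteq> I \<longleftrightarrow> J \<subseteq> upper_star N n I"
proof -
  have "A x k \<in> carrier N" if "A \<in> J" "x \<in> carrier (vec_group N n)" "k \<in> {1..n}" for A x k
    using matrix_apply_closed[of A n x] that assms by (auto simp: carrier_vec_group PiE_iff)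
  moreover have "A x \<in> extensional {1..n}" if "A \<in> J" "x \<in> carrier (vec_group N n)" for A x
    using matrix_apply_closed[of A n x] that assms by (auto simp: carrier_vec_group PiE_iff)
  ultimately show ?thesis
    using assms by (fastforce simp: lower_star_def upper_star_def PiE_iff)
qed

section \<open>Sums and products of elementary matrices\<close>

lemma elem_mat_add:
  assumes "i \<in> {1..n}" "j \<in> {1..n}" "a \<in> carrier N" "b \<in> carrier N"
  shows "elem_mat N n i j (a \<oplus> b) =
    elem_mat N n i j a \<oplus>\<^bsub>matrix_nearring N n\<^esub> elem_mat N n i j b"
proof -
  interpret M: right_nearring "matrix_nearring N n" by (rule right_nearring_matrix)
  show ?thesis
    by (rule matrix_eqI)
      (use assms in \<open>auto simp: elem_mat_closed matrix_add_apply elem_mat_apply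
        nr_r_distr carrier_vec_group PiE_iff\<close>)
qed

text \<open>Associativity gives row \<open>i\<close>, and all other rows vanish. With
  \<open>elem_mat_add\<close>, the case \<open>i = j = l = 1\<close> makes
  \<open>elem_mat N n 1 1\<close> a homomorphism.\<close>

lemma elem_mat_mult:
  assumes "i \<in> {1..n}" "j \<in> {1..n}" "l \<in> {1..n}" "a \<in> carrier N" "b \<in> carrier N"
  shows "elem_mat N n i l (a \<otimes> b) =
    elem_mat N n i j a \<otimes>\<^bsub>matrix_nearring N n\<^esub> elem_mat N n j l b"
proof -
  interpret M: right_nearring "matrix_nearring N n" by (rule right_nearring_matrix)
  show ?thesis
  proof (rule matrix_eqI)
    fix x k assume x: "x \<in> carrier (vec_group N n)" and k: "k \<in> {1..n}"
    have "elem_mat N n j l b x \<in> carrier (vec_group N n)"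
      using assms x by (intro matrix_apply_closed[OF elem_mat_closed])
    moreover have "x l \<in> carrier N"
      using x assms by (auto simp: carrier_vec_group)
    ultimately show "elem_mat N n i l (a \<otimes> b) x k =
        (elem_mat N n i j a \<otimes>\<^bsub>matrix_nearring N n\<^esub> elem_mat N n j l b) x k"
      using x k assms by (simp add: matrix_mult_apply elem_mat_apply nr_m_assoc)
  qed (use assms in \<open>auto intro!: elem_mat_closed nr_m_closed M.nr_m_closed\<close>)
qed

text \<open>\<open>B\<close> is the sum over \<open>k\<close> of the matrices
  \<open>elem_mat N n k l (\<rho> k)\<close>. It sends \<open>x\<close> to a right multiple of the
  prescribed vector \<open>\<rho>\<close>, which is the shape \<open>matrix_right_mult\<close>
  handles.\<close>

lemma column_matrix:
  assumes "\<rho> \<in> carrier (vec_group N n)" "l \<in> {1..n}"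
  obtains B where "B \<in> carrier (matrix_nearring N n)"
    and "\<And>x. x \<in> carrier (vec_group N n) \<Longrightarrow> B x = (\<lambda>k\<in>{1..n}. \<rho> k \<otimes> x l)"
proof -
  let ?M = "matrix_nearring N n"
  interpret M: right_nearring ?M by (rule right_nearring_matrix)
  \<comment> \<open>The sum is built row by row: after \<open>m\<close> summands the rows up to
    \<open>m\<close> are filled and the others are zero.\<close>
  have "\<exists>B\<in>carrier ?M. \<forall>x\<in>carrier (vec_group N n). \<forall>k\<in>{1..n}.
      B x k = (if k \<le> m then \<rho> k \<otimes> x l else \<zero>)" if "m \<le> n" for m
    using that
  proof (induction m)
    case 0
    then show ?case
      by (intro bexI[of _ "\<zero>\<^bsub>?M\<^esub>"]) (auto simp: matrix_zero_apply)
  next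
    case (Suc m)
    then obtain B where B: "B \<in> carrier ?M" "\<forall>x\<in>carrier (vec_group N n). \<forall>k\<in>{1..n}.
        B x k = (if k \<le> m then \<rho> k \<otimes> x l else \<zero>)"
      by auto
    have "\<rho> (Suc m) \<in> carrier N"
      using assms Suc.prems by (auto simp: carrier_vec_group)
    then have "elem_mat N n (Suc m) l (\<rho> (Suc m)) \<in> carrier ?M"
      using assms Suc.prems by (intro elem_mat_closed) auto
    \<comment> \<open>The new summand meets a zero in row \<open>Suc m\<close> and contributes zero
      to all other rows.\<close>
    then show ?case
      using B assms Suc.prems
      by (intro bexI[of _ "B \<oplus>\<^bsub>?M\<^esub> elem_mat N n (Suc m) l (\<rho> (Suc m))"])
        (auto simp: matrix_add_apply elem_mat_apply nr_m_closed carrier_vec_group PiE_iff)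
  qed
  from this[of n] obtain B where B: "B \<in> carrier ?M"
    "\<And>x k. x \<in> carrier (vec_group N n) \<Longrightarrow> k \<in> {1..n} \<Longrightarrow> B x k = \<rho> k \<otimes> x l"
    by auto
  have "B x = (\<lambda>k\<in>{1..n}. \<rho> k \<otimes> x l)" if "x \<in> carrier (vec_group N n)" for x
    using B matrix_apply_closed[OF B(1) that] that
    by (auto simp: fun_eq_iff carrier_vec_group PiE_iff extensional_def)
  with B(1) show thesis by (rule that)
qed

end

section \<open>Nearrings with identity: recovering elementary matrices from entries\<close>

locale nearring_with_one = right_nearring N + monoid N for N (structure)
begin

text \<open>Since \<open>N\<close> need not be zero-symmetric, ideals of \<open>M\<^sub>n(N)\<close> absorb only those left factors that
  fix \<open>0\<close>, such as \<open>f\<^sub>i\<^sub>j\<^sup>1\<close>.\<close>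

lemma ideal_unit_mat_mult:
  assumes J: "nearring_ideal J (matrix_nearring N n)" and "A \<in> J"
    and ij: "i \<in> {1..n}" "j \<in> {1..n}"
  shows "elem_mat N n i j \<one> \<otimes>\<^bsub>matrix_nearring N n\<^esub> A \<in> J"
proof -
  let ?M = "matrix_nearring N n" and ?E = "elem_mat N n i j \<one>"
  interpret M: right_nearring ?M by (rule right_nearring_matrix)
  have A: "A \<in> carrier ?M"
    using J \<open>A \<in> J\<close> subgroup.subset by (fastforce simp: M.nearring_ideal_iff)
  have E: "?E \<in> carrier ?M"
    using ij by (simp add: elem_mat_closed)
  \<comment> \<open>By \<open>\<one> \<otimes> \<zero> = \<zero>\<close> the matrix
    \<open>?E\<close> fixes the zero vector, so the ideal axiom on differences, taken at base point
    zero, says that \<open>?E\<close> times \<open>A\<close> lies in \<open>J\<close>.\<close>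
  have "?E \<otimes>\<^bsub>?M\<^esub> \<zero>\<^bsub>?M\<^esub> = \<zero>\<^bsub>?M\<^esub>"
  proof (rule matrix_eqI)
    fix x k assume "x \<in> carrier (vec_group N n)" "k \<in> {1..n}"
    then show "(?E \<otimes>\<^bsub>?M\<^esub> \<zero>\<^bsub>?M\<^esub>) x k = \<zero>\<^bsub>?M\<^esub> x k"
      using ij matrix_apply_closed[OF M.add.one_closed, of x]
      by (simp add: matrix_mult_apply elem_mat_apply matrix_zero_apply)
  qed (use E M.nr_m_closed in auto)
  moreover have "?E \<otimes>\<^bsub>?M\<^esub> (\<zero>\<^bsub>?M\<^esub> \<oplus>\<^bsub>?M\<^esub> A) \<ominus>\<^bsub>?M\<^esub> ?E \<otimes>\<^bsub>?M\<^esub> \<zero>\<^bsub>?M\<^esub> \<in> J"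
    using J E \<open>A \<in> J\<close> by (simp add: M.nearring_ideal_iff)
  ultimately show ?thesis
    using A E M.nr_m_closed by (simp add: a_minus_def)
qed

text \<open>Choose \<open>B\<close> with \<open>B y\<close> equal to \<open>\<rho>\<close> times
  \<open>y j\<close> on the right. By \<open>matrix_right_mult\<close>, entry \<open>l\<close> of
  \<open>A (B y)\<close> is \<open>x \<otimes> y j\<close>, and
  \<open>elem_mat N n i l \<one>\<close> moves it to row \<open>i\<close> and clears the rest. Right
  absorption puts the product of \<open>A\<close> and \<open>B\<close> into
  \<open>J\<close>.\<close>

lemma elem_mat_in_ideal:
  assumes J: "nearring_ideal J (matrix_nearring N n)" and x: "x \<in> lower_star N n J"
    and ij: "i \<in> {1..n}" "j \<in> {1..n}"
  shows "elem_mat N n i j x \<in> J"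
proof -
  let ?M = "matrix_nearring N n"
  interpret M: right_nearring ?M by (rule right_nearring_matrix)
  obtain A \<rho> l where A: "A \<in> J" "l \<in> {1..n}" "\<rho> \<in> carrier (vec_group N n)" "x = A \<rho> l"
    and "x \<in> carrier N"
    using x by (auto simp: lower_star_def)
  have A': "A \<in> carrier ?M"
    using J \<open>A \<in> J\<close> subgroup.subset by (fastforce simp: M.nearring_ideal_iff)
  obtain B where B: "B \<in> carrier ?M"
    "\<And>y. y \<in> carrier (vec_group N n) \<Longrightarrow> B y = (\<lambda>k\<in>{1..n}. \<rho> k \<otimes> y j)"
    using column_matrix[OF A(3) ij(2)] by blast
  have AB: "A \<otimes>\<^bsub>?M\<^esub> B \<in> J"
    using J A B by (simp add: M.nearring_ideal_iff)
  have "elem_mat N n i j x = elem_mat N n i l \<one> \<otimes>\<^bsub>?M\<^esub> (A \<otimes>\<^bsub>?M\<^esub> B)"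
  proof (rule matrix_eqI)
    fix y k assume y: "y \<in> carrier (vec_group N n)" and k: "k \<in> {1..n}"
    have "y j \<in> carrier N"
      using y ij by (auto simp: carrier_vec_group)
    moreover have "A (B y) \<in> carrier (vec_group N n)"
      by (rule matrix_apply_closed[OF A' matrix_apply_closed[OF B(1) y]])
    moreover have "A (B y) l = x \<otimes> y j"
      using matrix_right_mult[OF A' A(3) \<open>y j \<in> carrier N\<close> A(2)] B(2)[OF y] A(4) by simp
    ultimately show "elem_mat N n i j x y k =
        (elem_mat N n i l \<one> \<otimes>\<^bsub>?M\<^esub> (A \<otimes>\<^bsub>?M\<^esub> B)) y k"
      using y k \<open>x \<in> carrier N\<close> by (simp add: matrix_mult_apply elem_mat_apply nr_m_closed)
  qed (use ij A A' B \<open>x \<in> carrier N\<close> in \<open>auto simp: elem_mat_closed M.nr_m_closed\<close>)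
  then show ?thesis
    using ideal_unit_mat_mult[OF J AB ij(1) A(2)] by simp
qed

text \<open>The existential over matrices, positions and vectors is replaced by a test on a single
  elementary matrix, whose position may be chosen freely.\<close>

lemma lower_star_iff:
  assumes J: "nearring_ideal J (matrix_nearring N n)" and ij: "i \<in> {1..n}" "j \<in> {1..n}"
  shows "x \<in> lower_star N n J \<longleftrightarrow> x \<in> carrier N \<and> elem_mat N n i j x \<in> J"
proof
  assume "x \<in> lower_star N n J"
  then show "x \<in> carrier N \<and> elem_mat N n i j x \<in> J"
    using elem_mat_in_ideal[OF J _ ij] by (auto simp: lower_star_def)
next
  assume x: "x \<in> carrier N \<and> elem_mat N n i j x \<in> J"
  \<comment> \<open>At the vector of ones, entry \<open>i\<close> of
    \<open>elem_mat N n i j x\<close> is \<open>x \<otimes> \<one> = x\<close>.\<close>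
  have u: "(\<lambda>k\<in>{1..n}. \<one>) \<in> carrier (vec_group N n)"
    by (simp add: carrier_vec_group)
  then have "x = elem_mat N n i j x (\<lambda>k\<in>{1..n}. \<one>) i"
    using x ij by (simp add: elem_mat_apply)
  then show "x \<in> lower_star N n J"
    using x ij u unfolding lower_star_def by blast
qed

text \<open>Two elements of \<open>J_*\<close> may come from different matrices, positions and
  vectors, so closure under addition is not evident from the definition. The test by
  \<open>elem_mat N n 1 1\<close> exhibits \<open>J_*\<close> as a preimage of
  \<open>J\<close>.\<close>

lemma nearring_ideal_lower_star:
  assumes J: "nearring_ideal J (matrix_nearring N n)" and "n \<ge> 1"
  shows "nearring_ideal (lower_star N n J) N"
proof -
  have 1: "1 \<in> {1..n}"
    using \<open>n \<ge> 1\<close> by simp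
  have "lower_star N n J = {a \<in> carrier N. elem_mat N n 1 1 a \<in> J}"
    using lower_star_iff[OF J 1 1] by blast
  moreover have "nearring_ideal {a \<in> carrier N. elem_mat N n 1 1 a \<in> J} N"
    by (rule nearring_ideal_vimage[OF right_nearring_axioms right_nearring_matrix])
      (use 1 J in \<open>auto intro: elem_mat_closed elem_mat_add elem_mat_mult\<close>)
  ultimately show ?thesis by simp
qed

lemma upper_plus_subset_iff:
  assumes J: "nearring_ideal J (matrix_nearring N n)" and I: "I \<subseteq> carrier N" and "n \<ge> 1"
  shows "upper_plus N n I \<subseteq> J \<longleftrightarrow> I \<subseteq> lower_star N n J"
proof -
  have 1: "1 \<in> {1..n}"
    using \<open>n \<ge> 1\<close> by simp
  have "upper_plus N n I \<subseteq> J \<longleftrightarrow>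
      (\<forall>i\<in>{1..n}. \<forall>j\<in>{1..n}. \<forall>x\<in>I. elem_mat N n i j x \<in> J)"
    unfolding upper_plus_def genideal_nr_least[OF J] by blast
  \<comment> \<open>Membership in \<open>J\<close> is the same condition for all positions, and
    \<open>1 \<in> {1..n}\<close> keeps the quantifiers over them from being vacuous.\<close>
  also have "\<dots> \<longleftrightarrow> I \<subseteq> lower_star N n J"
    using I 1 lower_star_iff[OF J] by (meson subset_iff)
  finally show ?thesis .
qed

end

section \<open>The two Galois connections between the ideal lattices\<close>

lemma (in right_nearring) nearring_ideal_upper_plus:
  assumes "I \<subseteq> carrier N"
  shows "nearring_ideal (upper_plus N n I) (matrix_nearring N n)"
proof -
  interpret M: right_nearring "matrix_nearring N n" by (rule right_nearring_matrix)
  show ?thesis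
    unfolding upper_plus_def
    by (rule M.nearring_ideal_genideal) (use assms in \<open>auto intro: elem_mat_closed\<close>)
qed

lemma partial_order_ideal_order: "partial_order (ideal_order N)"
  by unfold_locales (auto simp: ideal_order_def)

lemma nearring_ideal_subset: "nearring_ideal I N \<Longrightarrow> I \<subseteq> carrier N"
  using normal_imp_subgroup subgroup.subset by (fastforce simp: nearring_ideal_def)

theorem theorem3p6:
  fixes N :: "('a, 'm) ring_scheme" and n :: nat
  assumes "right_nearring N" and "monoid N" and "n \<ge> 1"
  shows "isotone (ideal_order (matrix_nearring N n)) (ideal_order N) (lower_star N n)
    \<and> isotone (ideal_order N) (ideal_order (matrix_nearring N n)) (upper_star N n)
    \<and> isotone (ideal_order N) (ideal_order (matrix_nearring N n)) (upper_plus N n)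
    \<and> galois_connection
        \<lparr>orderA = ideal_order (matrix_nearring N n), orderB = ideal_order N,
         lower = lower_star N n, upper = upper_star N n\<rparr>
    \<and> galois_connection
        \<lparr>orderA = ideal_order N, orderB = ideal_order (matrix_nearring N n),
         lower = upper_plus N n, upper = lower_star N n\<rparr>"
proof -
  interpret nearring_with_one N
    using assms by (simp add: nearring_with_one_def)
  let ?M = "matrix_nearring N n"
  have star: "galois_connection
      \<lparr>orderA = ideal_order ?M, orderB = ideal_order N,
       lower = lower_star N n, upper = upper_star N n\<rparr>"
    by (intro galois_connection.intro connection.intro galois_connection_axioms.intro)
      (use nearring_ideal_lower_star nearring_ideal_upper_star
        lower_star_subset_iff[OF nearring_ideal_subset] assms(3) in
       \<open>simp_all add: partial_order_ideal_order, auto simp: ideal_order_def\<close>)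
  have plus: "galois_connection
      \<lparr>orderA = ideal_order N, orderB = ideal_order ?M,
       lower = upper_plus N n, upper = lower_star N n\<rparr>"
    by (intro galois_connection.intro connection.intro galois_connection_axioms.intro)
      (use nearring_ideal_lower_star nearring_ideal_upper_plus[OF nearring_ideal_subset]
        upper_plus_subset_iff[OF _ nearring_ideal_subset] assms(3) in
       \<open>simp_all add: partial_order_ideal_order, auto simp: ideal_order_def\<close>)
  \<comment> \<open>Monotonicity comes from the adjunctions: the first gives it for
    \<open>lower_star\<close> and \<open>upper_star\<close>, the second for
    \<open>upper_plus\<close>.\<close>
  show ?thesis
    using star plus galois_connection.lower_iso[OF star] galois_connection.upper_iso[OF star]
      galois_connection.lower_iso[OF plus]
    by simp
qed

end
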